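(* Let $G$ be a locally compact, a-T-menable group. For every proper function $f:G\to[1,\infty[$, there exists a continuous, conditionally negative definite, proper function $\psi$ on $G$ such that $\psi\le f$.
   Context: A 1-cocycle of $G$ is a continuous map $b:G\to\mathcal{H}$ to a Hilbert space carrying a continuous unitary or orthogonal representation $\pi$ of $G$, with $b(gh)=\pi(g)b(h)+b(g)$ for all $g,h\in G$. A locally compact group is a-T-menable if it has a 1-cocycle $b$ such that $g\mapsto\|b(g)\|$ is proper. A function $\psi:G\to\mathbf{R}_+$ is conditionally negative definite if $\psi(1)=0$, $\psi(g)=\psi(g^{-1})$ for all $g$, and $\sum_{i,j=1}^n\lambda_i\lambda_j\psi(g_i^{-1}g_j)\le0$ for all $g_1,\dots,g_n\in G$ and $\lambda_1,\dots,\lambda_n\in\mathbf{R}$ with $\sum_i\lambda_i=0$. A function $f:G\to\mathbf{R}_+$ (not necessarily continuous) is proper if $f(g)\to\infty$ as $g\to\infty$, i.e. $\{g: f(g)\le r\}$ is relatively compact for every $r$. *)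

theory Defs
  imports "HOL-Analysis.Analysis"
begin

text \<open>
  Topological groups are types of class \<^class>\<open>topological_group_add\<close>. These groups need not be
  commutative: the group law is written \<open>g + h\<close>, the inverse \<open>- g\<close> and the identity \<open>0\<close>, so that
  \<open>g\<inverse> h\<close> becomes \<open>- g + h\<close>.
\<close>

definition proper_fun :: "('g::topological_space \<Rightarrow> real) \<Rightarrow> bool" where
  "proper_fun f \<longleftrightarrow> (\<forall>r. compact (closure {g. f g \<le> r}))"

definition cond_neg_def :: "('g::group_add \<Rightarrow> real) \<Rightarrow> bool" where
  "cond_neg_def \<psi> \<longleftrightarrow>
     (\<forall>g. 0 \<le> \<psi> g) \<and> \<psi> 0 = 0 \<and> (\<forall>g. \<psi> g = \<psi> (- g)) \<and>
     (\<forall>(n::nat) (g :: nat \<Rightarrow> 'g) (c :: nat \<Rightarrow> real). (\<Sum>i<n. c i) = 0 \<longrightarrow>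
        (\<Sum>i<n. \<Sum>j<n. c i * c j * \<psi> (- g i + g j)) \<le> 0)"

text \<open>
  A complex Hilbert space is represented by its underlying real Hilbert space, with real inner
  product \<open>Re \<langle>x, y\<rangle>\<close>, together with the complex scalar multiplication and the complex
  inner product (linear in the second argument). Positive definiteness of \<open>cinner\<close> follows
  from \<open>cinner_commute\<close> and \<open>Re_cinner\<close>.
\<close>

locale complex_inner_product = vector_space scaleC
  for scaleC :: "complex \<Rightarrow> 'h::real_inner \<Rightarrow> 'h" +
  fixes cinner :: "'h \<Rightarrow> 'h \<Rightarrow> complex"
  assumes scaleC_of_real: "scaleC (complex_of_real r) x = r *\<^sub>R x"
    and cinner_add_right: "cinner x (y + z) = cinner x y + cinner x z"
    and cinner_scaleC_right: "cinner x (scaleC a y) = a * cinner x y"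
    and cinner_commute: "cinner x y = cnj (cinner y x)"
    and Re_cinner: "Re (cinner x y) = inner x y"

text \<open>
  Continuity of a representation is understood in the strong operator topology. The operators
  \<open>\<pi> g\<close> are automatically invertible, with inverse \<open>\<pi> (- g)\<close>.
\<close>

definition continuous_rep ::
    "('g::topological_group_add \<Rightarrow> 'h::real_inner \<Rightarrow> 'h) \<Rightarrow> bool" where
  "continuous_rep \<pi> \<longleftrightarrow>
     \<pi> 0 = id \<and> (\<forall>g h. \<pi> (g + h) = \<pi> g \<circ> \<pi> h) \<and> (\<forall>v. continuous_on UNIV (\<lambda>g. \<pi> g v))"

definition orthogonal_rep ::
    "('g::topological_group_add \<Rightarrow> 'h::real_inner \<Rightarrow> 'h) \<Rightarrow> bool" where
  "orthogonal_rep \<pi> \<longleftrightarrow> continuous_rep \<pi> \<and> (\<forall>g. orthogonal_transformation (\<pi> g))"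

definition unitary_rep ::
    "('g::topological_group_add \<Rightarrow> 'h::real_inner \<Rightarrow> 'h) \<Rightarrow> bool" where
  "unitary_rep \<pi> \<longleftrightarrow> continuous_rep \<pi> \<and>
     (\<exists>scaleC cinner. complex_inner_product scaleC cinner \<and>
        (\<forall>g. Vector_Spaces.linear scaleC scaleC (\<pi> g) \<and>
             (\<forall>v w. cinner (\<pi> g v) (\<pi> g w) = cinner v w)))"

definition cocycle ::
    "('g::topological_group_add \<Rightarrow> 'h::real_inner \<Rightarrow> 'h) \<Rightarrow> ('g \<Rightarrow> 'h) \<Rightarrow> bool" where
  "cocycle \<pi> b \<longleftrightarrow> (orthogonal_rep \<pi> \<or> unitary_rep \<pi>) \<and> continuous_on UNIV b \<and>
     (\<forall>g h. b (g + h) = \<pi> g (b h) + b g)"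

text \<open>
  HOL cannot quantify over Hilbert spaces inside a formula, so a-T-menability carries the Hilbert
  space \<open>'h\<close> as a type parameter: a group is a-T-menable if and only if this holds for some
  \<open>'h\<close>. As a hypothesis of a theorem, with \<open>'h\<close> occurring nowhere else, it
  says exactly that the group is a-T-menable.
\<close>

definition a_T_menable ::
    "'g::topological_group_add itself \<Rightarrow> 'h::{real_inner, complete_space} itself \<Rightarrow> bool" where
  "a_T_menable _ _ \<longleftrightarrow>
     (\<exists>(\<pi> :: 'g \<Rightarrow> 'h \<Rightarrow> 'h) b. cocycle \<pi> b \<and> proper_fun (\<lambda>g. norm (b g)))"

end

theory Submission
  imports Defs
begin

text \<open>
  Let \<open>b\<close> be a proper cocycle. Since \<open>\<parallel>b (- g + h)\<parallel> = \<parallel>b g - b h\<parallel>\<close>, the function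
  \<open>\<phi> = \<parallel>b\<parallel>\<^sup>2\<close> is a squared Hilbert space distance along the orbit map; it is continuous,
  conditionally negative definite and proper, but it may grow much faster than \<open>f\<close>. It is slowed
  down by composing it with a function \<open>F\<close> on \<open>[0, \<infinity>[\<close> of the form
  \<open>F x = (\<Sum>k. 1 - exp (- t\<^sub>k x)) / 2\<close>, where the \<open>t\<^sub>k > 0\<close> have a finite sum.

  Any such \<open>F\<close> is continuous and unbounded, because each summand tends to \<open>1\<close> as \<open>x\<close> grows, so
  \<open>F \<circ> \<phi>\<close> is continuous and proper. Schoenberg's theorem says that \<open>exp (- t \<phi>)\<close> is positive
  definite for \<open>t \<ge> 0\<close> (\<open>gaussian_kernel_psd\<close>). Subtracting a positive definite kernel from the
  constant \<open>1\<close> gives a conditionally negative definite one, so \<open>F \<circ> \<phi>\<close> is conditionally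
  negative definite (\<open>bernstein_norm_diff_cond_neg\<close>).

  The freedom in the choice of the \<open>t\<^sub>k\<close> makes \<open>F\<close> grow as slowly as required. As \<open>f\<close> is proper,
  the continuous function \<open>\<phi>\<close> is bounded by some \<open>S\<^sub>n\<close> on each set \<open>{f \<le> n + 1}\<close>. If \<open>t\<^sub>k\<close> is
  small compared with \<open>1 / S\<^sub>n\<close> for all \<open>n \<le> k\<close>, then at a point \<open>0 \<le> x \<le> S\<^sub>n\<close> the first \<open>n\<close> summands
  contribute at most \<open>n\<close> and all the others together at most \<open>1\<close>, so \<open>F x \<le> (n + 1) / 2\<close>
  (\<open>slow_bernstein_exists\<close>). For \<open>n \<ge> 1\<close> and \<open>n \<le> f g \<le> n + 1\<close> this gives
  \<open>F (\<phi> g) \<le> (n + 1) / 2 \<le> n \<le> f g\<close>. The factor \<open>1 / 2\<close> absorbs the final \<open>1\<close>, and this is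
  where the lower bound \<open>f \<ge> 1\<close> enters.
\<close>

section \<open>Positive definiteness of Gaussian kernels\<close>

text \<open>
  Schur's product theorem with one factor a Gram matrix. The Gram matrix is a sum of rank one
  matrices \<open>c i * c j\<close>, each of which turns the sum into a value of the quadratic form of \<open>A\<close>.
  These are split off one at a time, by a Gram--Schmidt step that projects all vectors to the
  orthogonal complement of one of them and so makes that one vanish.
\<close>

lemma schur_product_gram:
  fixes A :: "'i \<Rightarrow> 'i \<Rightarrow> real" and v :: "'i \<Rightarrow> 'h::real_inner"
  assumes "finite I"
    and psd: "\<And>c. 0 \<le> (\<Sum>i\<in>I. \<Sum>j\<in>I. c i * c j * A i j)"
  shows "0 \<le> (\<Sum>i\<in>I. \<Sum>j\<in>I. A i j * (v i \<bullet> v j))"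
proof -
  have "0 \<le> (\<Sum>i\<in>I. \<Sum>j\<in>I. A i j * (v i \<bullet> v j))"
    if "finite J" and "\<forall>i\<in>I - J. v i = 0" for J and v :: "'i \<Rightarrow> 'h"
    using that
  proof (induction J arbitrary: v rule: finite_induct)
    case empty
    then show ?case by simp
  next
    case (insert a J)
    \<comment> \<open>If \<open>v a = 0\<close>, both quotients are \<open>0\<close>, so that \<open>w = v\<close> and \<open>c = 0\<close>; the
      decomposition below then holds trivially.\<close>
    define w where "w i = v i - ((v a \<bullet> v i) / (v a \<bullet> v a)) *\<^sub>R v a" for i
    define c where "c i = (v a \<bullet> v i) / norm (v a)" for i
    have split: "v i \<bullet> v j = c i * c j + w i \<bullet> w j" for i j
    proof (cases "v a = 0")
      case True
      then show ?thesis by (simp add: w_def c_def)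
    next
      case False
      have "norm (v a) * norm (v a) = v a \<bullet> v a"
        by (metis dot_square_norm power2_eq_square)
      with False show ?thesis
        by (simp add: w_def c_def inner_diff inner_commute field_simps)
    qed
    have "\<forall>i\<in>I - J. w i = 0"
    proof
      fix i assume "i \<in> I - J"
      show "w i = 0"
      proof (cases "i = a")
        case False
        with insert.prems \<open>i \<in> I - J\<close> have "v i = 0" by blast
        then show ?thesis by (simp add: w_def)
      qed (simp add: w_def)
    qed
    then have "0 \<le> (\<Sum>i\<in>I. \<Sum>j\<in>I. A i j * (w i \<bullet> w j))"
      by (rule insert.IH)
    moreover have "(\<Sum>i\<in>I. \<Sum>j\<in>I. A i j * (v i \<bullet> v j))
        = (\<Sum>i\<in>I. \<Sum>j\<in>I. c i * c j * A i j) + (\<Sum>i\<in>I. \<Sum>j\<in>I. A i j * (w i \<bullet> w j))"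
      by (simp add: split algebra_simps sum.distrib)
    ultimately show ?case using psd[of c] by simp
  qed
  from this[OF \<open>finite I\<close>] show ?thesis by simp
qed

lemma gram_power_psd:
  fixes v :: "'i \<Rightarrow> 'h::real_inner"
  assumes "finite I"
  shows "0 \<le> (\<Sum>i\<in>I. \<Sum>j\<in>I. c i * c j * (v i \<bullet> v j) ^ k)"
proof (induction k arbitrary: c)
  case 0
  have "(\<Sum>i\<in>I. \<Sum>j\<in>I. c i * c j) = (\<Sum>i\<in>I. c i)\<^sup>2"
    by (simp add: power2_eq_square sum_product)
  then show ?case by simp
next
  case (Suc k)
  have "0 \<le> (\<Sum>i\<in>I. \<Sum>j\<in>I. (v i \<bullet> v j) ^ k * ((c i *\<^sub>R v i) \<bullet> (c j *\<^sub>R v j)))"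
    using \<open>finite I\<close> Suc.IH by (rule schur_product_gram)
  then show ?case by (simp add: algebra_simps)
qed

text \<open>
  Schoenberg's argument: expanding the square gives
  \<open>exp (- t \<parallel>x - y\<parallel>\<^sup>2) = exp (- t \<parallel>x\<parallel>\<^sup>2) exp (- t \<parallel>y\<parallel>\<^sup>2) exp (2 t (x \<bullet> y))\<close>. The first two factors
  only rescale the coefficients \<open>c\<close>, and the last one is a power series in the Gram kernel with
  nonnegative coefficients.
\<close>

lemma gaussian_kernel_psd:
  fixes v :: "'i \<Rightarrow> 'h::real_inner"
  assumes "finite I" and "0 \<le> t"
  shows "0 \<le> (\<Sum>i\<in>I. \<Sum>j\<in>I. c i * c j * exp (- (t * (norm (v i - v j))\<^sup>2)))"
proof -
  define d where "d i = c i * exp (- (t * (norm (v i))\<^sup>2))" for i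
  have gauss: "c i * c j * exp (- (t * (norm (v i - v j))\<^sup>2))
      = d i * d j * exp (2 * t * (v i \<bullet> v j))" for i j
  proof -
    have "- (t * (norm (v i - v j))\<^sup>2)
        = - (t * (norm (v i))\<^sup>2) + - (t * (norm (v j))\<^sup>2) + 2 * t * (v i \<bullet> v j)"
      by (simp add: power2_norm_eq_inner inner_diff inner_commute algebra_simps)
    then show ?thesis unfolding d_def by (simp only: exp_add mult_ac)
  qed
  let ?S = "\<lambda>k. \<Sum>i\<in>I. \<Sum>j\<in>I. d i * d j * ((2 * t * (v i \<bullet> v j)) ^ k /\<^sub>R fact k)"
  have "?S sums (\<Sum>i\<in>I. \<Sum>j\<in>I. d i * d j * exp (2 * t * (v i \<bullet> v j)))"
    by (intro sums_sum sums_mult exp_converges)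
  moreover have "0 \<le> ?S k" for k
  proof -
    have "?S k = (2 * t) ^ k / fact k * (\<Sum>i\<in>I. \<Sum>j\<in>I. d i * d j * (v i \<bullet> v j) ^ k)"
      by (simp add: sum_distrib_left power_mult_distrib field_simps)
    then show ?thesis using gram_power_psd[OF \<open>finite I\<close>, of d v k] \<open>0 \<le> t\<close> by simp
  qed
  ultimately have "0 \<le> (\<Sum>i\<in>I. \<Sum>j\<in>I. d i * d j * exp (2 * t * (v i \<bullet> v j)))"
    by (rule sums_le[OF _ sums_zero, rotated])
  then show ?thesis by (simp only: gauss)
qed

section \<open>Cocycles as affine isometric actions\<close>

text \<open>
  The maps \<open>v \<mapsto> \<pi> g v + b g\<close> are an action by affine isometries, and \<open>b\<close> is the orbit map of \<open>0\<close>;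
  moving by \<open>- g\<close> sends \<open>b g\<close> to \<open>0\<close> and \<open>b h\<close> to \<open>b (- g + h)\<close>. In the unitary case the real norm
  is preserved because the real inner product is the real part of the complex one.
\<close>

lemma cocycle_norm_diff:
  assumes "cocycle \<pi> b"
  shows "norm (b (- g + h)) = norm (b g - b h)"
proof -
  from assms have add: "b (g + h) = \<pi> g (b h) + b g" for g h
    by (simp add: cocycle_def)
  have isometry: "\<pi> x (v - w) = \<pi> x v - \<pi> x w \<and> norm (\<pi> x v) = norm v" for x v w
    using assms unfolding cocycle_def
  proof (elim conjE disjE)
    assume "orthogonal_rep \<pi>"
    then have "orthogonal_transformation (\<pi> x)" by (simp add: orthogonal_rep_def)
    then show ?thesis
      by (simp add: orthogonal_transformation linear_diff)
  next
    assume "unitary_rep \<pi>"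
    then obtain scaleC cinner
      where ip: "complex_inner_product scaleC cinner"
        and lin: "Vector_Spaces.linear scaleC scaleC (\<pi> x)"
        and pres: "\<And>v w. cinner (\<pi> x v) (\<pi> x w) = cinner v w"
      unfolding unitary_rep_def by blast
    interpret complex_inner_product scaleC cinner by (rule ip)
    interpret L: Vector_Spaces.linear scaleC scaleC "\<pi> x" by (rule lin)
    have "\<pi> x v \<bullet> \<pi> x v = v \<bullet> v"
      by (metis pres Re_cinner)
    then show ?thesis by (simp add: L.diff norm_eq_sqrt_inner)
  qed
  have "b 0 = 0"
  proof -
    have "\<pi> 0 = id"
      using assms unfolding cocycle_def orthogonal_rep_def unitary_rep_def continuous_rep_def
      by blast
    then show ?thesis using add[of 0 0] by simp
  qed
  then have "b (- g) = - \<pi> (- g) (b g)"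
    using add[of "- g" g] by (simp add: eq_neg_iff_add_eq_0 add.commute)
  then have "b (- g + h) = \<pi> (- g) (b h - b g)"
    by (simp add: add isometry)
  then have "norm (b (- g + h)) = norm (b h - b g)"
    using isometry by metis
  then show ?thesis by (simp add: norm_minus_commute)
qed

section \<open>Slowly growing Bernstein functions\<close>

text \<open>
  The Bernstein function without drift whose Levy measure has a unit mass at each \<open>t k\<close>. It is
  meaningful for \<open>x \<ge> 0\<close> and summable \<open>t\<close>.
\<close>

definition bernstein :: "(nat \<Rightarrow> real) \<Rightarrow> real \<Rightarrow> real" where
  "bernstein t x = (\<Sum>k. 1 - exp (- (t k * x)))"

lemma exp_neg_increment_le:
  fixes x y :: real
  assumes "0 \<le> x" and "x \<le> y"
  shows "exp (- x) - exp (- y) \<le> y - x"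
proof -
  have "exp (- x) - exp (- y) = exp (- x) * (1 - exp (- (y - x)))"
    by (simp add: right_diff_distrib flip: exp_add)
  also have "\<dots> \<le> 1 * (y - x)"
    using assms exp_ge_add_one_self[of "x - y"] by (intro mult_mono) (simp_all add: algebra_simps)
  finally show ?thesis by simp
qed

context
  fixes t :: "nat \<Rightarrow> real"
  assumes t_pos: "\<And>k. 0 < t k" and t_summable: "summable t"
begin

lemma bernstein_term_bounds:
  assumes "0 \<le> x"
  shows "0 \<le> 1 - exp (- (t k * x))" and "1 - exp (- (t k * x)) \<le> t k * x"
  using exp_ge_add_one_self[of "- (t k * x)"] assms t_pos[of k] by auto

lemma bernstein_summable:
  assumes "0 \<le> x"
  shows "summable (\<lambda>k. 1 - exp (- (t k * x)))"
proof (rule summable_comparison_test')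
  show "summable (\<lambda>k. t k * x)" by (intro summable_mult2 t_summable)
  show "norm (1 - exp (- (t k * x))) \<le> t k * x" if "k \<ge> 0" for k
    using bernstein_term_bounds[OF assms, of k] by simp
qed

lemma bernstein_nonneg: "0 \<le> x \<Longrightarrow> 0 \<le> bernstein t x"
  unfolding bernstein_def
  by (intro suminf_nonneg bernstein_summable bernstein_term_bounds)

text \<open>
  The Lipschitz estimate behind continuity: each summand is increasing, with slope at most \<open>t k\<close>.
\<close>

lemma bernstein_increment:
  assumes "0 \<le> x" and "x \<le> y"
  shows "\<bar>bernstein t y - bernstein t x\<bar> \<le> suminf t * (y - x)"
proof -
  have "(\<lambda>k. (1 - exp (- (t k * y))) - (1 - exp (- (t k * x))))
      sums (bernstein t y - bernstein t x)"
    unfolding bernstein_def using assms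
    by (intro sums_diff summable_sums bernstein_summable) auto
  moreover have "(\<lambda>k. t k * (y - x)) sums (suminf t * (y - x))"
    by (intro sums_mult2 summable_sums t_summable)
  moreover have "(1 - exp (- (t k * y))) - (1 - exp (- (t k * x))) \<le> t k * (y - x)" for k
    using exp_neg_increment_le[of "t k * x" "t k * y"] assms t_pos[of k]
    by (simp add: right_diff_distrib mult_left_mono)
  ultimately have "bernstein t y - bernstein t x \<le> suminf t * (y - x)"
    by (rule sums_le[rotated])
  moreover have "bernstein t x \<le> bernstein t y"
    unfolding bernstein_def using assms t_pos
    by (intro suminf_le bernstein_summable) (auto simp: less_imp_le mult_left_mono)
  ultimately show ?thesis by simp
qed

lemma bernstein_continuous: "continuous_on {0..} (bernstein t)"
proof (rule lipschitz_on_continuous_on)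
  show "(suminf t)-lipschitz_on {0..} (bernstein t)"
  proof (rule lipschitz_onI)
    fix x y :: real
    assume "x \<in> {0..}" "y \<in> {0..}"
    then show "dist (bernstein t x) (bernstein t y) \<le> suminf t * dist x y"
      using bernstein_increment[of x y] bernstein_increment[of y x]
      by (cases "x \<le> y") (auto simp: dist_real_def abs_minus_commute)
  qed (use t_summable t_pos in \<open>simp add: suminf_nonneg less_imp_le\<close>)
qed

lemma bernstein_lower_bound:
  assumes "0 \<le> x" and "\<And>k. k < K \<Longrightarrow> 1 \<le> t k * x"
  shows "real K / 2 \<le> bernstein t x"
proof -
  have half: "1 / 2 \<le> 1 - exp (- (t k * x))" if "k < K" for k
  proof -
    have "2 \<le> exp (t k * x)"
      using exp_ge_add_one_self[of "t k * x"] assms(2)[OF that] by linarith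
    then show ?thesis by (simp add: exp_minus field_simps)
  qed
  have "real K / 2 = (\<Sum>k<K. 1 / 2)" by simp
  also have "\<dots> \<le> (\<Sum>k<K. 1 - exp (- (t k * x)))"
    using half by (intro sum_mono) simp
  also have "\<dots> \<le> bernstein t x"
    unfolding bernstein_def using assms(1)
    by (intro sum_le_suminf bernstein_summable bernstein_term_bounds) auto
  finally show ?thesis .
qed

text \<open>
  The quantitative form of \<open>F x \<rightarrow> \<infinity>\<close> from which properness of the composite is read off: once \<open>x\<close>
  exceeds the reciprocals of the first \<open>K\<close> of the \<open>t k\<close>, these terms contribute at least \<open>K / 2\<close>.
\<close>

lemma bernstein_sublevel_bounded:
  obtains R where "\<And>x. 0 \<le> x \<Longrightarrow> bernstein t x \<le> r \<Longrightarrow> x \<le> R"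
proof -
  obtain K :: nat where K: "2 * r < real K" using reals_Archimedean2 by blast
  define R where "R = (\<Sum>k<K. 1 / t k)"
  have "x \<le> R" if "0 \<le> x" "bernstein t x \<le> r" for x
  proof (rule ccontr)
    assume "\<not> x \<le> R"
    have "1 \<le> t k * x" if "k < K" for k
    proof -
      have "1 / t k \<le> R"
        unfolding R_def using that t_pos by (intro member_le_sum) (auto simp: less_imp_le)
      with \<open>\<not> x \<le> R\<close> have "1 / t k \<le> x" by simp
      then show ?thesis using t_pos[of k] by (simp add: field_simps)
    qed
    from bernstein_lower_bound[of x K, OF \<open>0 \<le> x\<close> this] K that(2)
    show False by linarith
  qed
  then show ?thesis by (rule that)
qed

text \<open>
  When the coefficients sum to \<open>0\<close>, the constant \<open>1\<close> in each summand drops out, and what remains is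
  minus a Gaussian quadratic form.
\<close>

lemma bernstein_norm_diff_cond_neg:
  fixes v :: "'i \<Rightarrow> 'h::real_inner"
  assumes "finite I" and "(\<Sum>i\<in>I. c i) = 0"
  shows "(\<Sum>i\<in>I. \<Sum>j\<in>I. c i * c j * bernstein t ((norm (v i - v j))\<^sup>2)) \<le> 0"
proof -
  let ?S = "\<lambda>k. \<Sum>i\<in>I. \<Sum>j\<in>I. c i * c j * (1 - exp (- (t k * (norm (v i - v j))\<^sup>2)))"
  have "?S sums (\<Sum>i\<in>I. \<Sum>j\<in>I. c i * c j * bernstein t ((norm (v i - v j))\<^sup>2))"
    unfolding bernstein_def
    by (intro sums_sum sums_mult summable_sums bernstein_summable) simp
  moreover have "?S k \<le> 0" for k
  proof -
    have "(\<Sum>i\<in>I. \<Sum>j\<in>I. c i * c j) = 0"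
      using assms(2) by (simp flip: sum_product)
    then have "?S k = - (\<Sum>i\<in>I. \<Sum>j\<in>I. c i * c j * exp (- (t k * (norm (v i - v j))\<^sup>2)))"
      by (simp add: right_diff_distrib sum_subtractf)
    then show ?thesis
      using gaussian_kernel_psd[OF \<open>finite I\<close> less_imp_le[OF t_pos], of c k v] by simp
  qed
  ultimately show ?thesis by (rule sums_le[OF _ _ sums_zero, rotated])
qed

end

text \<open>
  However fast \<open>S\<close> grows, some Bernstein function grows at most linearly along it. The parameters
  \<open>t\<close> are chosen so that \<open>t k * S n \<le> (1 / 2) ^ Suc k\<close> whenever \<open>n \<le> k\<close>; these bounds add up to at
  most \<open>1\<close>, and the summands with \<open>k < n\<close> are at most \<open>1\<close> each.
\<close>

lemma slow_bernstein_exists: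
  fixes S :: "nat \<Rightarrow> real"
  obtains t where "\<And>k. 0 < t k" and "summable t"
    and "\<And>n x. 0 \<le> x \<Longrightarrow> x \<le> S n \<Longrightarrow> bernstein t x \<le> real n + 1"
proof -
  \<comment> \<open>A nonnegative increasing majorant of \<open>S\<close>; adding \<open>1\<close> below makes it invertible.\<close>
  define T where "T n = (\<Sum>k\<le>n. \<bar>S k\<bar>)" for n
  define t where "t k = (1 / 2) ^ Suc k / (1 + T k)" for k
  have T_nonneg: "0 \<le> T n" for n by (simp add: T_def sum_nonneg)
  have T_pos: "0 < 1 + T n" for n using T_nonneg[of n] by simp
  have t_pos: "0 < t k" for k unfolding t_def by (intro divide_pos_pos T_pos) simp
  have half_sums: "(\<lambda>k. (1 / 2) ^ Suc k :: real) sums 1"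
    by (rule power_half_series)
  have t_le: "t k \<le> (1 / 2) ^ Suc k" for k
    unfolding t_def using T_nonneg[of k] by (simp add: divide_le_eq mult_le_cancel_left1)
  have t_summable: "summable t"
    using sums_summable[OF half_sums]
    by (rule summable_comparison_test') (use t_pos t_le in \<open>simp add: less_imp_le abs_of_pos\<close>)
  have "bernstein t x \<le> real n + 1" if "0 \<le> x" and "x \<le> S n" for n x
  proof -
    \<comment> \<open>A summable majorant of the terms of the series at \<open>x\<close>, with sum \<open>n + 1\<close>.\<close>
    define m where "m k = (if k < n then 1 else 0::real) + (1 / 2) ^ Suc k" for k
    have "1 - exp (- (t k * x)) \<le> m k" for k
    proof (cases "k < n")
      case True
      then show ?thesis by (simp add: m_def add_increasing2 less_imp_le)
    next
      case False
      have "S n \<le> T k"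
      proof -
        have "\<bar>S n\<bar> \<le> T k"
          unfolding T_def using False by (intro member_le_sum) auto
        then show ?thesis by linarith
      qed
      then have "t k * x \<le> t k * (1 + T k)"
        using that t_pos[of k] by (intro mult_left_mono) auto
      also have "\<dots> = (1 / 2) ^ Suc k"
        unfolding t_def using T_pos[of k] by (simp only: times_divide_eq_left nonzero_mult_div_cancel_right less_imp_neq[symmetric] not_False_eq_True)
      finally show ?thesis
        using bernstein_term_bounds(2)[OF t_pos t_summable \<open>0 \<le> x\<close>, of k] False
        by (simp add: m_def)
    qed
    moreover have "(\<lambda>k. 1 - exp (- (t k * x))) sums bernstein t x"
      unfolding bernstein_def
      by (intro summable_sums bernstein_summable t_pos t_summable \<open>0 \<le> x\<close>)
    moreover have "m sums (real n + 1)"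
    proof -
      have "(\<lambda>k. if k < n then 1 else 0::real) sums real n"
        using sums_If_finite_set[of "{..<n}" "\<lambda>_. 1::real"] by simp
      then show ?thesis unfolding m_def by (intro sums_add half_sums)
    qed
    ultimately show ?thesis by (rule sums_le)
  qed
  with t_pos t_summable show ?thesis by (rule that)
qed

section \<open>Proper functions\<close>

lemma continuous_bounded_on_sublevel:
  fixes f \<phi> :: "'g::topological_space \<Rightarrow> real"
  assumes "proper_fun f" and "continuous_on UNIV \<phi>"
  shows "\<exists>B. \<forall>g. f g \<le> r \<longrightarrow> \<phi> g \<le> B"
proof -
  have "compact (\<phi> ` closure {g. f g \<le> r})"
    using assms by (intro compact_continuous_image) (auto simp: proper_fun_def intro: continuous_on_subset)
  then have "bdd_above (\<phi> ` closure {g. f g \<le> r})"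
    by (intro bounded_imp_bdd_above compact_imp_bounded)
  then obtain B where B: "\<And>g. g \<in> closure {g. f g \<le> r} \<Longrightarrow> \<phi> g \<le> B"
    by (auto simp: bdd_above_def)
  have "\<phi> g \<le> B" if "f g \<le> r" for g
    by (rule B, rule subsetD[OF closure_subset]) (simp add: that)
  then show ?thesis by blast
qed

lemma proper_fun_if_sublevels_subset:
  assumes "proper_fun p" and "\<And>r. \<exists>s. {g. q g \<le> r} \<subseteq> {g. p g \<le> s}"
  shows "proper_fun q"
  unfolding proper_fun_def
proof
  fix r
  obtain s where "closure {g. q g \<le> r} \<subseteq> closure {g. p g \<le> s}"
    using assms(2)[of r] closure_mono by blast
  then have "closure {g. q g \<le> r} = closure {g. p g \<le> s} \<inter> closure {g. q g \<le> r}"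
    by blast
  then show "compact (closure {g. q g \<le> r})"
    using compact_Int_closed[OF _ closed_closure] assms(1) by (metis proper_fun_def)
qed

section \<open>Conditionally negative definite functions of slow growth\<close>

theorem proposition3p10:
  fixes f :: "'g::topological_group_add \<Rightarrow> real"
  assumes "locally_compact_space (euclidean :: 'g topology)"
    and "a_T_menable TYPE('g) TYPE('h::{real_inner, complete_space})"
    and "\<And>g. 1 \<le> f g"
    and "proper_fun f"
  shows "\<exists>\<psi> :: 'g \<Rightarrow> real. continuous_on UNIV \<psi> \<and> cond_neg_def \<psi> \<and> proper_fun \<psi> \<and>
           (\<forall>g. \<psi> g \<le> f g)"
proof -
  obtain \<pi> :: "'g \<Rightarrow> 'h \<Rightarrow> 'h" and b
    where coc: "cocycle \<pi> b" and b_proper: "proper_fun (\<lambda>g. norm (b g))"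
    using assms(2) unfolding a_T_menable_def by blast
  define \<phi> where "\<phi> g = (norm (b g))\<^sup>2" for g
  have cont: "continuous_on UNIV \<phi>"
    using coc unfolding \<phi>_def cocycle_def by (intro continuous_intros) blast
  have \<phi>_nonneg: "0 \<le> \<phi> g" for g by (simp add: \<phi>_def)
  have \<phi>_diff: "\<phi> (- g + h) = (norm (b g - b h))\<^sup>2" for g h
    by (simp add: \<phi>_def cocycle_norm_diff[OF coc])
  have \<phi>_zero: "\<phi> 0 = 0" using \<phi>_diff[of 0 0] by simp
  have \<phi>_sym: "\<phi> (- g) = \<phi> g" for g
    using \<phi>_diff[of g 0] \<phi>_diff[of 0 g] by (simp add: norm_minus_commute)

  have "\<forall>n. \<exists>B. \<forall>g. f g \<le> real n + 1 \<longrightarrow> \<phi> g \<le> B"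
    using continuous_bounded_on_sublevel[OF assms(4) cont] by blast
  then obtain S where "\<forall>n g. f g \<le> real n + 1 \<longrightarrow> \<phi> g \<le> S n"
    by (rule choice[THEN exE])
  then have S: "\<And>n g. f g \<le> real n + 1 \<Longrightarrow> \<phi> g \<le> S n" by blast
  obtain t where t: "\<And>k. 0 < t k" "summable t"
    and slow: "\<And>n x. 0 \<le> x \<Longrightarrow> x \<le> S n \<Longrightarrow> bernstein t x \<le> real n + 1"
    by (rule slow_bernstein_exists[of S]) (rule that)
  define \<psi> where "\<psi> g = bernstein t (\<phi> g) / 2" for g

  have "continuous_on UNIV \<psi>"
    unfolding \<psi>_def using \<phi>_nonneg
    by (intro continuous_intros continuous_on_compose2[OF bernstein_continuous[OF t] cont]) auto
  moreover have "cond_neg_def \<psi>"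
    unfolding cond_neg_def_def
  proof (intro conjI allI impI)
    show "0 \<le> \<psi> g" for g
      unfolding \<psi>_def using bernstein_nonneg[OF t \<phi>_nonneg] by simp
    show "\<psi> 0 = 0" by (simp add: \<psi>_def \<phi>_zero bernstein_def)
    show "\<psi> g = \<psi> (- g)" for g by (simp add: \<psi>_def \<phi>_sym)
    fix n :: nat and g :: "nat \<Rightarrow> 'g" and c :: "nat \<Rightarrow> real"
    assume "(\<Sum>i<n. c i) = 0"
    with bernstein_norm_diff_cond_neg[OF t, of "{..<n}" c "\<lambda>i. b (g i)"]
    show "(\<Sum>i<n. \<Sum>j<n. c i * c j * \<psi> (- g i + g j)) \<le> 0"
      by (simp add: \<psi>_def \<phi>_diff flip: sum_divide_distrib)
  qed
  moreover have "proper_fun \<psi>"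
    using b_proper
  proof (rule proper_fun_if_sublevels_subset)
    fix r
    obtain R where R: "\<And>x. 0 \<le> x \<Longrightarrow> bernstein t x \<le> 2 * r \<Longrightarrow> x \<le> R"
      using bernstein_sublevel_bounded[OF t] by blast
    have "norm (b g) \<le> sqrt R" if "\<psi> g \<le> r" for g
      using R[OF \<phi>_nonneg, of g] that by (simp add: \<psi>_def \<phi>_def real_le_rsqrt)
    then show "\<exists>s. {g. \<psi> g \<le> r} \<subseteq> {g. norm (b g) \<le> s}" by blast
  qed
  moreover have "\<psi> g \<le> f g" for g
  proof -
    define n where "n = nat \<lfloor>f g\<rfloor>"
    have n: "real n \<le> f g" "f g \<le> real n + 1" "1 \<le> n"
      unfolding n_def using assms(3)[of g] by linarith+
    have "bernstein t (\<phi> g) \<le> real n + 1"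
      by (intro slow \<phi>_nonneg S n)
    then show ?thesis using n unfolding \<psi>_def by linarith
  qed
  ultimately show ?thesis by blast
qed

end
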